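(* Let $\Sigma$ be a Riemann surface and let $X:\Sigma\to\mathbb{R}^3$ be an immersion with non-zero Gauss--Kronecker curvature whose Gauss map is, in a local complex parameter $z=u_1+iu_2$, $$N=\frac{(2g,\,1-|g|^2)}{1+|g|^2},$$ where $g$ is a holomorphic function with $g'\neq 0$. Let $\ell:\mathbb{R}\to\mathbb{R}$ be a function with $\ell'\neq 0$, let $f$ be a holomorphic function on $\Sigma$, let $\mu=\langle 1,f\rangle$, and suppose that the support function $h=\langle X,N\rangle$ of $X$ is $h=\ell(\mu)$ and is nowhere zero. Then $$X=\sum_{j=1}^{2}\frac{h_{,j}}{L_{jj}}N_{,j}+hN ,$$ and $X$ is a GRT-surface with respect to the harmonic function $\mu$ and the function $$C=\frac{\ell\,\ell''}{(\ell')^2}.$$ Furthermore, $X(\Sigma)$ is locally parameterized by $$X=\frac{\ell'(\mu)}{2|g'|^2}\Big(T g'\overline{f'}-2g\langle g',gf'\rangle,\;-2\langle g',gf'\rangle\Big)+\ell(\mu)\,\frac{(2g,\,2-T)}{T},\qquad T=1+|g|^2 .$$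
   Context: All functions are smooth. $\mathbb{R}^3$ is identified with $\mathbb{C}\times\mathbb{R}$. For complex numbers, $\langle a,b\rangle=\mathrm{Re}(a\bar b)$ (the real inner product on $\mathbb{C}$), so $\langle 1,f\rangle=\mathrm{Re} f$; for vectors of $\mathbb{R}^3$, $\langle\cdot,\cdot\rangle$ is the Euclidean product. A subscript $,j$ denotes $\partial/\partial u_j$; $f',g'$ are derivatives with respect to $z$. The third fundamental form is $L_{ij}=\langle N_{,i},N_{,j}\rangle=\frac{4|g'|^2}{(1+|g|^2)^2}\delta_{ij}$. For an oriented surface with Gauss map $N$, put $\Psi(p)=\langle p,N(p)\rangle$ (support function) and $\Lambda(p)=\langle p,p\rangle$ (quadratic distance function). $K$ is the Gauss curvature and $H=(k_1+k_2)/2$ is the mean curvature, where $k_1,k_2$ are the eigenvalues of $-dN$. A surface with $K\neq 0$ and $\Psi\neq 0$ everywhere is a GRT-surface (surface of generalized Ribaucour type, also written TRG-surface) with respect to a function $\mu$ that is harmonic for the third fundamental form and a function $C:\mathbb{R}\to\mathbb{R}$ if $$\frac{H}{K}=C(\mu)\left(\frac{-\Lambda}{2\Psi}+\frac{\Psi}{2}\right)-\Psi .$$ *)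

theory Defs
  imports "HOL-Complex_Analysis.Complex_Analysis"
begin

section \<open>Smooth functions\<close>

primrec Ck_on :: "nat \<Rightarrow> 'a::real_normed_vector set \<Rightarrow> ('a \<Rightarrow> 'b::real_normed_vector) \<Rightarrow> bool" where
  "Ck_on 0 U F \<longleftrightarrow> continuous_on U F"
| "Ck_on (Suc k) U F \<longleftrightarrow>
     (\<forall>x\<in>U. F differentiable (at x)) \<and> (\<forall>v. Ck_on k U (\<lambda>x. frechet_derivative F (at x) v))"

text \<open>Only meant for open domains, since derivatives are taken in the full space.\<close>

definition smooth_on :: "'a::real_normed_vector set \<Rightarrow> ('a \<Rightarrow> 'b::real_normed_vector) \<Rightarrow> bool" where
  "smooth_on U F \<longleftrightarrow> (\<forall>k. Ck_on k U F)"


section \<open>Riemann surfaces\<close>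

type_synonym 'a chart = "'a set \<times> ('a \<Rightarrow> complex)"

definition complex_chart :: "'a topology \<Rightarrow> 'a set \<Rightarrow> ('a \<Rightarrow> complex) \<Rightarrow> bool" where
  "complex_chart S U \<phi> \<longleftrightarrow>
     openin S U \<and> open (\<phi> ` U) \<and> homeomorphic_map (subtopology S U) (top_of_set (\<phi> ` U)) \<phi>"

definition riemann_surface :: "'a topology \<Rightarrow> 'a chart set \<Rightarrow> bool" where
  "riemann_surface S A \<longleftrightarrow>
     Hausdorff_space S \<and> connected_space S \<and>
     (\<forall>(U, \<phi>)\<in>A. complex_chart S U \<phi>) \<and>
     (\<Union>(U, \<phi>)\<in>A. U) = topspace S \<and>
     (\<forall>(U, \<phi>)\<in>A. \<forall>(V, \<psi>)\<in>A. (\<psi> \<circ> inv_into U \<phi>) holomorphic_on (\<phi> ` (U \<inter> V)))"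

text \<open>
  The expression of a function on the surface in the local complex parameter \<open>z = \<phi> p\<close>;
  it is meaningful on \<open>\<phi> ` U\<close> only.
\<close>

definition in_chart :: "'a set \<Rightarrow> ('a \<Rightarrow> complex) \<Rightarrow> ('a \<Rightarrow> 'b) \<Rightarrow> complex \<Rightarrow> 'b" where
  "in_chart U \<phi> F = F \<circ> inv_into U \<phi>"

definition holomorphic_on_surface :: "'a chart set \<Rightarrow> ('a \<Rightarrow> complex) \<Rightarrow> bool" where
  "holomorphic_on_surface A f \<longleftrightarrow> (\<forall>(U, \<phi>)\<in>A. in_chart U \<phi> f holomorphic_on (\<phi> ` U))"


section \<open>Coordinate expressions\<close>

text \<open>
  Real coordinates are \<open>z = u\<^sub>1 + \<i> u\<^sub>2\<close>, and \<open>pd j\<close> is the partial derivative with respect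
  to \<open>u\<^sub>j\<close> for \<open>j \<in> {1, 2}\<close>. Euclidean space of dimension three is \<open>complex \<times> real\<close>, whose
  library inner product is the Euclidean one; on \<open>complex\<close>, \<open>inner a b = Re (a * cnj b)\<close>.
\<close>

definition pd :: "nat \<Rightarrow> (complex \<Rightarrow> 'b::real_normed_vector) \<Rightarrow> complex \<Rightarrow> 'b" where
  "pd j F z = frechet_derivative F (at z) (if j = 1 then 1 else \<i>)"

definition third_form ::
  "(complex \<Rightarrow> complex \<times> real) \<Rightarrow> nat \<Rightarrow> nat \<Rightarrow> complex \<Rightarrow> real" where
  "third_form n i j z = inner (pd i n z) (pd j n z)"

definition metric_det :: "(nat \<Rightarrow> nat \<Rightarrow> complex \<Rightarrow> real) \<Rightarrow> complex \<Rightarrow> real" where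
  "metric_det G z = G 1 1 z * G 2 2 z - G 1 2 z * G 2 1 z"

text \<open>Entries of the inverse of the matrix \<open>G\<close>; for \<open>i \<in> {1, 2}\<close>, \<open>3 - i\<close> is the other index.\<close>

definition metric_inv ::
  "(nat \<Rightarrow> nat \<Rightarrow> complex \<Rightarrow> real) \<Rightarrow> nat \<Rightarrow> nat \<Rightarrow> complex \<Rightarrow> real" where
  "metric_inv G i j z =
     (if i = j then G (3 - i) (3 - i) z else - G i j z) / metric_det G z"

definition laplace_beltrami ::
  "(nat \<Rightarrow> nat \<Rightarrow> complex \<Rightarrow> real) \<Rightarrow> (complex \<Rightarrow> real) \<Rightarrow> complex \<Rightarrow> real" where
  "laplace_beltrami G u z =
     (\<Sum>i\<in>{1, 2}. pd i (\<lambda>w. sqrt (metric_det G w) *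
        (\<Sum>j\<in>{1, 2}. metric_inv G i j w * pd j u w)) z) / sqrt (metric_det G z)"

text \<open>
  The eigenvalues, in increasing order and with multiplicity, of the endomorphism \<open>-dn\<close> of the
  tangent plane of the patch \<open>x\<close> at \<open>z\<close>. Tangent vectors are written as \<open>dx(v)\<close> with \<open>v\<close> in
  the parameter plane, so the eigenvector equation is \<open>-dn(v) = k dx(v)\<close>. For an immersion \<open>x\<close>
  with smooth unit normal \<open>n\<close> an eigenbasis exists, since \<open>-dn\<close> is self-adjoint.
\<close>

definition principal_curvatures ::
  "(complex \<Rightarrow> complex \<times> real) \<Rightarrow> (complex \<Rightarrow> complex \<times> real) \<Rightarrow> complex \<Rightarrow> real \<times> real" where
  "principal_curvatures x n z =
     (THE (k\<^sub>1, k\<^sub>2). k\<^sub>1 \<le> k\<^sub>2 \<and>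
        (\<exists>v\<^sub>1 v\<^sub>2. v\<^sub>1 \<noteq> v\<^sub>2 \<and> independent {v\<^sub>1, v\<^sub>2} \<and>
           - frechet_derivative n (at z) v\<^sub>1 = k\<^sub>1 *\<^sub>R frechet_derivative x (at z) v\<^sub>1 \<and>
           - frechet_derivative n (at z) v\<^sub>2 = k\<^sub>2 *\<^sub>R frechet_derivative x (at z) v\<^sub>2))"

definition gauss_curvature ::
  "(complex \<Rightarrow> complex \<times> real) \<Rightarrow> (complex \<Rightarrow> complex \<times> real) \<Rightarrow> complex \<Rightarrow> real" where
  "gauss_curvature x n z = (case principal_curvatures x n z of (k\<^sub>1, k\<^sub>2) \<Rightarrow> k\<^sub>1 * k\<^sub>2)"

definition mean_curvature ::
  "(complex \<Rightarrow> complex \<times> real) \<Rightarrow> (complex \<Rightarrow> complex \<times> real) \<Rightarrow> complex \<Rightarrow> real" where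
  "mean_curvature x n z = (case principal_curvatures x n z of (k\<^sub>1, k\<^sub>2) \<Rightarrow> (k\<^sub>1 + k\<^sub>2) / 2)"

definition support_function ::
  "('a \<Rightarrow> complex \<times> real) \<Rightarrow> ('a \<Rightarrow> complex \<times> real) \<Rightarrow> 'a \<Rightarrow> real" where
  "support_function X N p = inner (X p) (N p)"

definition quadratic_distance :: "('a \<Rightarrow> complex \<times> real) \<Rightarrow> 'a \<Rightarrow> real" where
  "quadratic_distance X p = inner (X p) (X p)"


section \<open>Immersed surfaces\<close>

definition immersion :: "'a chart set \<Rightarrow> ('a \<Rightarrow> complex \<times> real) \<Rightarrow> bool" where
  "immersion A X \<longleftrightarrow>
     (\<forall>(U, \<phi>)\<in>A. smooth_on (\<phi> ` U) (in_chart U \<phi> X) \<and>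
        (\<forall>z\<in>\<phi> ` U. inj (frechet_derivative (in_chart U \<phi> X) (at z))))"

text \<open>
  The orientation of the immersed surface is the choice of the unit normal field \<open>N\<close>; it need not
  be the one induced by the complex structure.
\<close>

definition gauss_map ::
  "'a chart set \<Rightarrow> ('a \<Rightarrow> complex \<times> real) \<Rightarrow> ('a \<Rightarrow> complex \<times> real) \<Rightarrow> bool" where
  "gauss_map A X N \<longleftrightarrow>
     (\<forall>(U, \<phi>)\<in>A. smooth_on (\<phi> ` U) (in_chart U \<phi> N) \<and>
        (\<forall>z\<in>\<phi> ` U. norm (in_chart U \<phi> N z) = 1 \<and>
           (\<forall>v. inner (frechet_derivative (in_chart U \<phi> X) (at z) v) (in_chart U \<phi> N z) = 0)))"

definition nonzero_curvature ::
  "'a chart set \<Rightarrow> ('a \<Rightarrow> complex \<times> real) \<Rightarrow> ('a \<Rightarrow> complex \<times> real) \<Rightarrow> bool" where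
  "nonzero_curvature A X N \<longleftrightarrow>
     (\<forall>(U, \<phi>)\<in>A. \<forall>z\<in>\<phi> ` U. gauss_curvature (in_chart U \<phi> X) (in_chart U \<phi> N) z \<noteq> 0)"

definition harmonic_third_form ::
  "'a chart set \<Rightarrow> ('a \<Rightarrow> complex \<times> real) \<Rightarrow> ('a \<Rightarrow> real) \<Rightarrow> bool" where
  "harmonic_third_form A N \<mu> \<longleftrightarrow>
     (\<forall>(U, \<phi>)\<in>A. smooth_on (\<phi> ` U) (in_chart U \<phi> \<mu>) \<and>
        (\<forall>z\<in>\<phi> ` U. laplace_beltrami (third_form (in_chart U \<phi> N)) (in_chart U \<phi> \<mu>) z = 0))"

definition GRT_surface ::
  "'a chart set \<Rightarrow> ('a \<Rightarrow> complex \<times> real) \<Rightarrow> ('a \<Rightarrow> complex \<times> real) \<Rightarrow>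
   ('a \<Rightarrow> real) \<Rightarrow> (real \<Rightarrow> real) \<Rightarrow> bool" where
  "GRT_surface A X N \<mu> C \<longleftrightarrow>
     immersion A X \<and> gauss_map A X N \<and> nonzero_curvature A X N \<and>
     harmonic_third_form A N \<mu> \<and> smooth_on UNIV C \<and>
     (\<forall>(U, \<phi>)\<in>A. \<forall>z\<in>\<phi> ` U.
        let x = in_chart U \<phi> X; n = in_chart U \<phi> N; m = in_chart U \<phi> \<mu>;
            \<Psi> = support_function x n z; \<Lambda> = quadratic_distance x z
        in \<Psi> \<noteq> 0 \<and>
           mean_curvature x n z / gauss_curvature x n z = C (m z) * (- \<Lambda> / (2 * \<Psi>) + \<Psi> / 2) - \<Psi>)"

text \<open>In the parameter \<open>z\<close> of the chart, the Gauss map is the inverse stereographic image of \<open>g\<close>.\<close>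

definition gauss_map_given_by ::
  "'a set \<Rightarrow> ('a \<Rightarrow> complex) \<Rightarrow> ('a \<Rightarrow> complex \<times> real) \<Rightarrow> (complex \<Rightarrow> complex) \<Rightarrow> bool" where
  "gauss_map_given_by U \<phi> N g \<longleftrightarrow>
     g holomorphic_on (\<phi> ` U) \<and> (\<forall>z\<in>\<phi> ` U. deriv g z \<noteq> 0) \<and>
     (\<forall>z\<in>\<phi> ` U. in_chart U \<phi> N z =
        (2 * g z, 1 - (cmod (g z))\<^sup>2) /\<^sub>R (1 + (cmod (g z))\<^sup>2))"

end

theory Submission
  imports Defs
begin

text \<open>
  A surface with nonvanishing curvature is locally governed by its support function \<open>h\<close>, regarded as a
  function on the unit sphere by means of the Gauss map \<open>N\<close>: it is the tangential gradient of \<open>h\<close>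
  plus \<open>h N\<close>, and \<open>dX = dN \<circ> S\<close>, where \<open>S = Hess h + h I\<close> is taken for the third fundamental form
  \<open>L\<close>. The principal curvatures are the numbers \<open>- 1 / s\<close> for the eigenvalues \<open>s\<close> of \<open>S\<close>, so \<open>2 H / K\<close> is
  minus the trace of \<open>S\<close>:
  \<open>H / K = - \<Delta>h / 2 - h\<close> with the Laplacian \<open>\<Delta>\<close> of \<open>L\<close>. If \<open>h = l(\<mu>)\<close> with \<open>\<mu>\<close> harmonic, then
  \<open>\<Delta>h = l''(\<mu>) |\<nabla>\<mu>|\<^sup>2\<close>, while \<open>\<Lambda> - \<Psi>\<^sup>2 = |\<nabla>h|\<^sup>2 = l'(\<mu>)\<^sup>2 |\<nabla>\<mu>|\<^sup>2\<close>. Eliminating \<open>|\<nabla>\<mu>|\<^sup>2\<close> gives the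
  equation of generalized Ribaucour type with \<open>C = l l'' / l'\<^sup>2\<close>.

  Where \<open>N\<close> is the inverse stereographic image of a holomorphic \<open>g\<close>, all of this is explicit.
  Stereographic projection is conformal (\<open>inner_dstereo\<close>), so \<open>L\<close> is a multiple of the Euclidean metric
  and \<open>\<mu> = Re f\<close> is harmonic (\<open>harmonic\<close>). The Gauss formula of the sphere in this parameter
  (\<open>dstereo_has_derivative\<close>) has a complex bilinear Christoffel term. Differentiating \<open>\<langle>X, N\<rangle> = l(Re f)\<close>
  once yields \<open>X\<close> (\<open>position_eq\<close>), and a second time yields \<open>S v = \<tau> v + q cnj v\<close> with a real number \<open>\<tau>\<close>,
  half the trace (\<open>dx_eq_dn_shape\<close>). This form makes the eigenvalues of \<open>S\<close> evident
  (\<open>mean_over_gauss_curvature\<close>).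

  In a chart whose parameter admits no such \<open>g\<close> globally, one is imported near each point from
  another chart (\<open>gauss_patch_near\<close>); every assertion is local.
\<close>

section \<open>Inverse stereographic projection\<close>

definition stereo :: "complex \<Rightarrow> complex \<times> real" where
  "stereo w = (2 * w, 1 - (cmod w)\<^sup>2) /\<^sub>R (1 + (cmod w)\<^sup>2)"

text \<open>
  The differential of \<open>stereo\<close>, in closed form.
\<close>

definition dstereo :: "complex \<Rightarrow> complex \<Rightarrow> complex \<times> real" where
  "dstereo w u = (2 / (1 + (cmod w)\<^sup>2)\<^sup>2) *\<^sub>R (u - w\<^sup>2 * cnj u, - 2 * inner w u)"

lemma one_plus_sq_pos: "0 < 1 + (cmod w)\<^sup>2" "1 + (cmod w)\<^sup>2 \<noteq> 0"
  by (smt (verit) zero_le_power2)+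

lemma cmod_mult_self: "cmod w * cmod w = Re w * Re w + Im w * Im w"
  by (simp flip: power2_eq_square cmod_power2)

lemma inner_stereo_self: "inner (stereo w) (stereo w) = 1"
proof -
  have "inner (2 * w, 1 - (cmod w)\<^sup>2) (2 * w, 1 - (cmod w)\<^sup>2) = (1 + (cmod w)\<^sup>2)\<^sup>2"
    by (simp add: inner_complex_def cmod_mult_self power2_eq_square algebra_simps)
  then show ?thesis unfolding stereo_def inner_scaleR_left inner_scaleR_right
    using one_plus_sq_pos[of w] by (simp add: divide_simps power2_eq_square)
qed

lemma inner_stereo_dstereo: "inner (stereo w) (dstereo w u) = 0"
proof -
  have "inner (2 * w, 1 - (cmod w)\<^sup>2) (u - w\<^sup>2 * cnj u, - 2 * inner w u) = 0"
    by (simp add: inner_complex_def cmod_mult_self power2_eq_square algebra_simps)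
  then show ?thesis unfolding stereo_def dstereo_def inner_scaleR_left inner_scaleR_right
    by simp
qed

text \<open>
  Stereographic projection is conformal; this is what makes the third fundamental form of a surface
  whose Gauss map is \<open>stereo \<circ> g\<close> a multiple of the identity matrix.
\<close>

lemma inner_dstereo: "inner (dstereo w u) (dstereo w v) = 4 / (1 + (cmod w)\<^sup>2)\<^sup>2 * inner u v"
proof -
  have "inner (u - w\<^sup>2 * cnj u, - 2 * inner w u) (v - w\<^sup>2 * cnj v, - 2 * inner w v)
      = (1 + (cmod w)\<^sup>2)\<^sup>2 * inner u v"
    by (simp add: inner_complex_def cmod_mult_self power2_eq_square algebra_simps)
  then show ?thesis unfolding dstereo_def inner_scaleR_left inner_scaleR_right
    using one_plus_sq_pos(2)[of w] by (simp add: divide_simps power2_eq_square)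
qed

lemma linear_dstereo: "linear (dstereo w)"
  by (rule linearI)
     (simp_all add: dstereo_def scaleR_conv_of_real[symmetric] add_divide_distrib[symmetric] algebra_simps)

lemma stereo_has_derivative: "(stereo has_derivative dstereo w) (at w)"
proof -
  have "((\<lambda>w. (2 * w, 1 - inner w w) /\<^sub>R (1 + inner w w)) has_derivative dstereo w) (at w)"
    using one_plus_sq_pos[of w]
    apply (auto intro!: derivative_eq_intros ext prod_eqI complex_eqI simp: dstereo_def  power2_norm_eq_inner)
    apply (auto simp: inner_complex_def divide_simps power2_eq_square)
      apply (auto simp: algebra_simps)
    done
  then show ?thesis by (simp add: stereo_def[abs_def] power2_norm_eq_inner)
qed

text \<open>
  The second derivative of \<open>stereo\<close>, in the form of the Gauss formula of the unit sphere. Its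
  normal part is minus the metric times the normal. Its tangential part is the Levi-Civita
  connection of the conformal metric \<open>4 / T\<^sup>2 |dw|\<^sup>2\<close>, \<open>T = 1 + |w|\<^sup>2\<close>, whose Christoffel term
  sends \<open>(u, v)\<close> to the complex bilinear \<open>- 2 cnj w u v / T\<close>. Complex bilinearity is the point:
  the term is symmetric, and it has no trace.
\<close>

lemma dstereo_has_derivative:
  assumes G: "(G has_derivative G') (at z)" and a: "(a has_derivative a') (at z)"
  shows "((\<lambda>z. dstereo (G z) (a z)) has_derivative
     (\<lambda>k. dstereo (G z) (a' k - 2 * cnj (G z) * a z * G' k / of_real (1 + (cmod (G z))\<^sup>2))
          - (4 / (1 + (cmod (G z))\<^sup>2)\<^sup>2 * inner (a z) (G' k)) *\<^sub>R stereo (G z))) (at z)"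
proof -
  define D where "D = (\<lambda>k. - (8 * inner (G z) (G' k) / (1 + inner (G z) (G z))^3) *\<^sub>R
      (a z - (G z)\<^sup>2 * cnj (a z), - 2 * inner (G z) (a z)) +
      (2 / (1 + inner (G z) (G z))\<^sup>2) *\<^sub>R (a' k - 2 * G z * G' k * cnj (a z) - (G z)\<^sup>2 * cnj (a' k),
       - 2 * (inner (G' k) (a z) + inner (G z) (a' k))))"
  have "((\<lambda>z. (2 / (1 + inner (G z) (G z))\<^sup>2) *\<^sub>R (a z - (G z)\<^sup>2 * cnj (a z), - 2 * inner (G z) (a z)))
     has_derivative D) (at z)"
    apply (rule derivative_eq_intros refl G a)+
    subgoal using one_plus_sq_pos[of "G z"] by (simp add: power2_norm_eq_inner)
     apply (rule derivative_eq_intros refl G a)+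
    subgoal using one_plus_sq_pos[of "G z"] unfolding D_def power2_norm_eq_inner
       by (auto simp: fun_eq_iff scaleR_conv_of_real inner_commute divide_simps eval_nat_numeral)
    done
  moreover have "D = (\<lambda>k. dstereo (G z) (a' k - 2 * cnj (G z) * a z * G' k / of_real (1 + (cmod (G z))\<^sup>2))
          - (4 / (1 + (cmod (G z))\<^sup>2)\<^sup>2 * inner (a z) (G' k)) *\<^sub>R stereo (G z))"
  proof
    fix k
    \<comment> \<open>Both sides are rational in the real and imaginary parts, with powers of \<open>T\<close> as denominators:
      clear these before \<open>T\<close> is expanded.\<close>
    define w u p q where "w = G z" "u = a z" "p = G' k" "q = a' k"
    define T where "T = 1 + inner w w"
    have T: "T \<noteq> 0" using one_plus_sq_pos(2)[of w] by (simp add: T_def power2_norm_eq_inner)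
    have "- (8 * inner w p / T^3) *\<^sub>R (u - w\<^sup>2 * cnj u, - 2 * inner w u) +
      (2 / T\<^sup>2) *\<^sub>R (q - 2 * w * p * cnj u - w\<^sup>2 * cnj q, - 2 * (inner p u + inner w q)) =
      (2 / T\<^sup>2) *\<^sub>R ((q - 2 * cnj w * u * p / of_real T) - w\<^sup>2 * cnj (q - 2 * cnj w * u * p / of_real T),
        - 2 * inner w (q - 2 * cnj w * u * p / of_real T)) - (4 / T\<^sup>2 * inner u p) *\<^sub>R ((2 * w, 2 - T) /\<^sub>R T)"
      using T
      apply (intro prod_eqI complex_eqI)
      apply (simp_all add: inner_complex_def divide_simps power2_eq_square power3_eq_cube)
      by (simp_all add: T_def inner_complex_def algebra_simps)
    then show "D k = dstereo (G z) (a' k - 2 * cnj (G z) * a z * G' k / of_real (1 + (cmod (G z))\<^sup>2))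
          - (4 / (1 + (cmod (G z))\<^sup>2)\<^sup>2 * inner (a z) (G' k)) *\<^sub>R stereo (G z)"
      unfolding D_def dstereo_def stereo_def T_def power2_norm_eq_inner w_u_p_q_def by simp
  qed
  ultimately show ?thesis by (simp only: dstereo_def power2_norm_eq_inner)
qed
text \<open>
  The image of \<open>dstereo w\<close> and the line through \<open>stereo w\<close> span the whole space: a vector with zero
  inner product against them all is zero. The witness \<open>c\<close> below is, up to a positive factor, the
  adjoint of \<open>dstereo w\<close> applied to \<open>Y\<close>, so it vanishes as soon as \<open>Y\<close> is orthogonal to the image.
\<close>

lemma orthogonal_stereo_frame_imp_zero:
  assumes "inner Y (stereo w) = 0" "\<And>u. inner Y (dstereo w u) = 0"
  shows "Y = 0"
proof -
  obtain \<xi> t where Y: "Y = (\<xi>, t)" by (cases Y)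
  define c where "c = \<xi> - w\<^sup>2 * cnj \<xi> - 2 * of_real t * w"
  define T where "T = 1 + (cmod w)\<^sup>2"
  have T: "T \<noteq> 0" "1 + (cmod w)\<^sup>2 = T" "1 - (cmod w)\<^sup>2 = 2 - T"
    using one_plus_sq_pos(2)[of w] by (auto simp: T_def)
  have "inner Y (dstereo w u) = 2 / T\<^sup>2 * inner c u" for u
    using T(1) unfolding dstereo_def Y T(2) c_def
    by (simp add: inner_complex_def divide_simps power2_eq_square algebra_simps)
  from this[of c] assms(2)[of c] T(1) have "c = 0" by simp
  moreover have "Y = dstereo w (c / 2) + inner Y (stereo w) *\<^sub>R stereo w"
    using T(1) unfolding dstereo_def stereo_def Y T(2,3) c_def
    apply (intro prod_eqI complex_eqI)
    apply (simp_all add: inner_complex_def divide_simps power2_eq_square)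
    by (simp_all add: T_def cmod_mult_self power2_eq_square algebra_simps)
  ultimately show ?thesis
    using assms(1) linear_0[OF linear_dstereo] by simp
qed

section \<open>Principal curvatures from the inverse shape operator\<close>

lemma in_real_span_if_ratio_real:
  fixes v w :: complex
  assumes "cnj v * w = cnj w * v" "v \<noteq> 0"
  shows "w \<in> span {v}"
proof -
  have "Im (cnj v * w) = 0"
    using arg_cong[OF assms(1), of Im] by (simp add: mult.commute)
  then have "cnj v * w = of_real (Re (cnj v * w))"
    by (simp add: complex_eq_iff)
  then have "v * cnj v * w = of_real (Re (cnj v * w)) * v"
    by (metis mult.assoc mult.commute)
  then have "w = (Re (cnj v * w) / (cmod v)\<^sup>2) *\<^sub>R v"
    using assms(2) by (simp add: complex_norm_square[symmetric] scaleR_conv_of_real divide_simps mult_ac)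
  then show ?thesis
    by (metis span_base span_mul insertI1)
qed

lemma independent_pair_notin_span:
  assumes "v \<noteq> w" "independent {v, w}"
  shows "w \<notin> span {v}" "v \<noteq> 0"
  using assms by (auto simp: independent_insert insert_commute[of v w] dependent_zero)

text \<open>
  The real linear map \<open>v \<mapsto> q cnj v\<close> of the plane has trace \<open>0\<close> and determinant \<open>- |q|\<^sup>2\<close>. A direct
  argument replaces the matrix: every eigenvalue has modulus \<open>|q|\<close>, and if two independent
  eigenvectors had the same nonzero eigenvalue, their arguments would agree modulo \<open>\<pi>\<close>.
\<close>

lemma antilinear_eigenvalues_sum_prod:
  fixes v\<^sub>1 v\<^sub>2 q :: complex and d\<^sub>1 d\<^sub>2 :: real
  assumes ind: "v\<^sub>1 \<noteq> v\<^sub>2" "independent {v\<^sub>1, v\<^sub>2}"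
    and eig: "q * cnj v\<^sub>1 = of_real d\<^sub>1 * v\<^sub>1" "q * cnj v\<^sub>2 = of_real d\<^sub>2 * v\<^sub>2"
  shows "d\<^sub>1 + d\<^sub>2 = 0 \<and> d\<^sub>1 * d\<^sub>2 = - (cmod q)\<^sup>2"
proof -
  have nz: "v\<^sub>1 \<noteq> 0" "v\<^sub>2 \<noteq> 0"
    using ind independent_pair_notin_span[of v\<^sub>2 v\<^sub>1] independent_pair_notin_span[of v\<^sub>1 v\<^sub>2]
    by (auto simp: insert_commute)
  have abs: "\<bar>d\<^sub>1\<bar> = cmod q" "\<bar>d\<^sub>2\<bar> = cmod q"
    using arg_cong[OF eig(1), of cmod] arg_cong[OF eig(2), of cmod] nz by (auto simp: norm_mult)
  have "q = 0" if "d\<^sub>1 = d\<^sub>2"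
  proof (rule ccontr)
    assume "q \<noteq> 0"
    moreover have "q * (cnj v\<^sub>1 * v\<^sub>2) = q * (cnj v\<^sub>2 * v\<^sub>1)"
      using eig that by (metis mult.assoc mult.commute)
    ultimately show False
      using in_real_span_if_ratio_real[of v\<^sub>1 v\<^sub>2] nz independent_pair_notin_span(1)[OF ind] by auto
  qed
  with abs have "d\<^sub>2 = - d\<^sub>1" by fastforce
  with abs show ?thesis by (simp flip: power2_eq_square) (metis power2_abs)
qed

lemma same_sum_same_prod:
  fixes a\<^sub>1 a\<^sub>2 b\<^sub>1 b\<^sub>2 :: real
  assumes "a\<^sub>1 + a\<^sub>2 = b\<^sub>1 + b\<^sub>2" "a\<^sub>1 * a\<^sub>2 = b\<^sub>1 * b\<^sub>2"
  shows "a\<^sub>1 = b\<^sub>1 \<and> a\<^sub>2 = b\<^sub>2 \<or> a\<^sub>1 = b\<^sub>2 \<and> a\<^sub>2 = b\<^sub>1"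
proof -
  have a2: "a\<^sub>2 = b\<^sub>1 + b\<^sub>2 - a\<^sub>1" using assms(1) by simp
  have "(a\<^sub>1 - b\<^sub>1) * (a\<^sub>1 - b\<^sub>2) = 0" using assms(2) unfolding a2 by (simp add: algebra_simps)
  with assms(1) show ?thesis by auto
qed

text \<open>
  A real linear map of the plane that is symmetric for the Euclidean inner product has the form
  \<open>v \<mapsto> \<tau> v + q cnj v\<close> with \<open>\<tau>\<close> real, half the trace. If \<open>dx = dn \<circ> S\<close> for such an \<open>S\<close>, then \<open>-dn(v) = k dx(v)\<close>
  means that \<open>v\<close> is an eigenvector of \<open>S\<close> with eigenvalue \<open>- 1 / k\<close>, so the sum \<open>1/k\<^sub>1 + 1/k\<^sub>2\<close>, which is
  \<open>2 H / K\<close>, is minus the trace of \<open>S\<close>. The principal curvatures are given by a definite description,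
  so the proof also has to show that exactly one ordered pair qualifies: sum and product of the
  \<open>1/k\<^sub>i\<close> are forced, and an eigenbasis is exhibited.
\<close>

lemma mean_over_gauss_curvature:
  fixes x n :: "complex \<Rightarrow> complex \<times> real" and z :: complex and \<tau> :: real and q :: complex
  defines "Dx \<equiv> frechet_derivative x (at z)" and "Dn \<equiv> frechet_derivative n (at z)"
  assumes lin: "linear Dn" and injn: "inj Dn" and injx: "inj Dx"
    and Dx: "\<And>v. Dx v = Dn (\<tau> *\<^sub>R v + q * cnj v)"
  shows "mean_curvature x n z / gauss_curvature x n z = - \<tau>"
proof -
  define P where "P = (\<lambda>(k\<^sub>1, k\<^sub>2). k\<^sub>1 \<le> k\<^sub>2 \<and>
        (\<exists>v\<^sub>1 v\<^sub>2. v\<^sub>1 \<noteq> v\<^sub>2 \<and> independent {v\<^sub>1, v\<^sub>2} \<and>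
           - Dn v\<^sub>1 = k\<^sub>1 *\<^sub>R Dx v\<^sub>1 \<and> - Dn v\<^sub>2 = k\<^sub>2 *\<^sub>R Dx v\<^sub>2))"
  have eig_iff: "- Dn v = k *\<^sub>R Dx v \<longleftrightarrow> k \<noteq> 0 \<and> q * cnj v = of_real (- 1 / k - \<tau>) * v" if "v \<noteq> 0" for v k
  proof -
    have "- Dn v = k *\<^sub>R Dx v \<longleftrightarrow> Dn (- v) = Dn (k *\<^sub>R (\<tau> *\<^sub>R v + q * cnj v))"
      using lin by (simp add: Dx linear_neg linear_scale)
    also have "\<dots> \<longleftrightarrow> - v = k *\<^sub>R (\<tau> *\<^sub>R v + q * cnj v)"
      using injn by (simp add: inj_eq)
    also have "\<dots> \<longleftrightarrow> k \<noteq> 0 \<and> q * cnj v = of_real (- 1 / k - \<tau>) * v"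
      using that by (cases "k = 0") (auto simp: scaleR_conv_of_real field_simps add_eq_0_iff)
    finally show ?thesis .
  qed
  have P_sum_prod: "k\<^sub>1 \<noteq> 0 \<and> k\<^sub>2 \<noteq> 0 \<and> 1 / k\<^sub>1 + 1 / k\<^sub>2 = - 2 * \<tau> \<and> (1 / k\<^sub>1) * (1 / k\<^sub>2) = \<tau>\<^sup>2 - (cmod q)\<^sup>2"
    if "P (k\<^sub>1, k\<^sub>2)" for k\<^sub>1 k\<^sub>2
  proof -
    from that obtain v\<^sub>1 v\<^sub>2 where v: "v\<^sub>1 \<noteq> v\<^sub>2" "independent {v\<^sub>1, v\<^sub>2}"
      "- Dn v\<^sub>1 = k\<^sub>1 *\<^sub>R Dx v\<^sub>1" "- Dn v\<^sub>2 = k\<^sub>2 *\<^sub>R Dx v\<^sub>2" by (auto simp: P_def)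
    then have nz: "v\<^sub>1 \<noteq> 0" "v\<^sub>2 \<noteq> 0" using dependent_zero[of "{v\<^sub>1, v\<^sub>2}"] by auto
    from v(3,4) eig_iff nz have k: "k\<^sub>1 \<noteq> 0" "k\<^sub>2 \<noteq> 0"
      and e: "q * cnj v\<^sub>1 = of_real (- 1 / k\<^sub>1 - \<tau>) * v\<^sub>1" "q * cnj v\<^sub>2 = of_real (- 1 / k\<^sub>2 - \<tau>) * v\<^sub>2" by blast+
    from antilinear_eigenvalues_sum_prod[OF v(1,2) e]
    have s: "1 / k\<^sub>1 + 1 / k\<^sub>2 = - 2 * \<tau>" and "(1 / k\<^sub>1 + \<tau>) * (1 / k\<^sub>2 + \<tau>) = - (cmod q)\<^sup>2"
      by (auto simp: algebra_simps)
    moreover have "(1 / k\<^sub>1 + \<tau>) * (1 / k\<^sub>2 + \<tau>) = (1 / k\<^sub>1) * (1 / k\<^sub>2) + \<tau> * (1 / k\<^sub>1 + 1 / k\<^sub>2) + \<tau>\<^sup>2"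
      by (simp add: algebra_simps power2_eq_square)
    ultimately have "(1 / k\<^sub>1) * (1 / k\<^sub>2) + \<tau> * (- 2 * \<tau>) + \<tau>\<^sup>2 = - (cmod q)\<^sup>2"
      unfolding s by simp
    then have "(1 / k\<^sub>1) * (1 / k\<^sub>2) = \<tau>\<^sup>2 - (cmod q)\<^sup>2"
      unfolding power2_eq_square by linarith
    with s k show ?thesis by blast
  qed
  have "\<exists>k\<^sub>1 k\<^sub>2. P (k\<^sub>1, k\<^sub>2)"
  proof -
    \<comment> \<open>The square root of \<open>q\<close> spans the eigenline of \<open>v \<mapsto> q cnj v\<close> for the eigenvalue \<open>|q|\<close>, and \<open>\<i>\<close>
      times it the one for \<open>- |q|\<close>.\<close>
    define v where "v = (if q = 0 then 1 else csqrt q)"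
    have v: "v \<noteq> 0" "q * cnj v = of_real (cmod q) * v"
    proof -
      show "v \<noteq> 0" by (simp add: v_def)
      have "q * cnj (csqrt q) = of_real (cmod q) * csqrt q"
      proof -
        have "q * cnj (csqrt q) = csqrt q * (csqrt q * cnj (csqrt q))"
          by (metis mult.assoc power2_csqrt power2_eq_square)
        also have "csqrt q * cnj (csqrt q) = of_real (cmod q)"
          by (metis complex_norm_square norm_power power2_csqrt)
        finally show ?thesis by (simp add: mult.commute)
      qed
      then show "q * cnj v = of_real (cmod q) * v" by (simp add: v_def)
    qed
    define w where "w = \<i> * v"
    have w: "w \<noteq> 0" "q * cnj w = of_real (- cmod q) * w"
      using v by (auto simp: w_def)
    have ind: "v \<noteq> w" "independent {v, w}"
    proof -
      have "w \<notin> span {v}"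
      proof
        assume "w \<in> span {v}"
        then obtain r where "\<i> * v = of_real r * v"
          by (auto simp: span_singleton w_def scaleR_conv_of_real)
        with v(1) have "\<i> = of_real r" by simp
        from arg_cong[OF this, of Im] show False by simp
      qed
      moreover from this have "v \<noteq> w" using span_base[of v "{v}"] by blast
      moreover have "independent {v}" using v(1) by simp
      ultimately have "independent {w, v}" "v \<noteq> w"
        using independent_insertI[of w "{v}"] by blast+
      then show "v \<noteq> w" "independent {v, w}"
        by (simp_all add: insert_commute[of w v])
    qed
    define k where "k = (\<lambda>e. - 1 / (\<tau> + e * cmod q))"
    have k: "- Dn u = k e *\<^sub>R Dx u" if "u \<noteq> 0" "q * cnj u = of_real (e * cmod q) * u" for e u
    proof -
      have "Dx u = Dn ((\<tau> + e * cmod q) *\<^sub>R u)"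
        using that(2) by (simp add: Dx scaleR_conv_of_real algebra_simps)
      moreover have "Dx u \<noteq> 0"
      proof -
        have "Dx 0 = 0" using lin by (simp add: Dx linear_0)
        then show ?thesis using injx that(1) by (metis injD)
      qed
      ultimately have "\<tau> + e * cmod q \<noteq> 0" using lin by (auto simp: linear_0)
      then show ?thesis using that by (subst eig_iff) (auto simp: k_def)
    qed
    have kvw: "- Dn v = k 1 *\<^sub>R Dx v" "- Dn w = k (-1) *\<^sub>R Dx w"
      using k[of v 1] k[of w "-1"] v w by auto
    show ?thesis
    proof (cases "k 1 \<le> k (-1)")
      case True
      then have "P (k 1, k (-1))" using ind kvw unfolding P_def prod.case by force
      then show ?thesis by blast
    next
      case False
      moreover have "w \<noteq> v" "independent {w, v}" using ind by (simp_all add: insert_commute[of w v])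
      ultimately have "P (k (-1), k 1)" using kvw unfolding P_def prod.case by force
      then show ?thesis by blast
    qed
  qed
  then obtain k\<^sub>1 k\<^sub>2 where k: "P (k\<^sub>1, k\<^sub>2)" by blast
  have "(THE p. P p) = (k\<^sub>1, k\<^sub>2)"
  proof (rule the_equality[where P = P, OF k])
    fix p assume "P p"
    moreover obtain j\<^sub>1 j\<^sub>2 where p: "p = (j\<^sub>1, j\<^sub>2)" by (cases p)
    ultimately have j: "P (j\<^sub>1, j\<^sub>2)" by simp
    have "1 / j\<^sub>1 = 1 / k\<^sub>1 \<and> 1 / j\<^sub>2 = 1 / k\<^sub>2 \<or> 1 / j\<^sub>1 = 1 / k\<^sub>2 \<and> 1 / j\<^sub>2 = 1 / k\<^sub>1"
      using P_sum_prod[OF j] P_sum_prod[OF k] by (intro same_sum_same_prod) auto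
    with j k show "p = (k\<^sub>1, k\<^sub>2)"
      using P_sum_prod[OF j] P_sum_prod[OF k] by (auto simp: p P_def)
  qed
  then have "principal_curvatures x n z = (k\<^sub>1, k\<^sub>2)"
    by (simp add: principal_curvatures_def P_def Dx_def Dn_def)
  then have "mean_curvature x n z / gauss_curvature x n z = (k\<^sub>1 + k\<^sub>2) / 2 / (k\<^sub>1 * k\<^sub>2)"
    by (simp add: mean_curvature_def gauss_curvature_def)
  also have "\<dots> = (1 / k\<^sub>1 + 1 / k\<^sub>2) / 2"
    using conjunct1[OF P_sum_prod[OF k]] conjunct1[OF conjunct2[OF P_sum_prod[OF k]]]
    by (simp add: field_simps)
  also have "\<dots> = - \<tau>"
    using P_sum_prod[OF k] by simp
  finally show ?thesis .
qed

section \<open>Closure properties of smooth functions\<close>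

lemma Ck_on_Suc_has_derivative:
  assumes "Ck_on (Suc k) U F" "x \<in> U"
  shows "(F has_derivative frechet_derivative F (at x)) (at x)"
  using assms frechet_derivative_works by auto

lemma Ck_on_cong:
  assumes "open U" "Ck_on k U F" "\<And>x. x \<in> U \<Longrightarrow> F x = G x"
  shows "Ck_on k U G"
  using assms(2,3)
proof (induction k arbitrary: F G)
  case 0
  then show ?case by (simp cong: continuous_on_cong)
next
  case (Suc k)
  have D: "(G has_derivative frechet_derivative F (at x)) (at x)" if "x \<in> U" for x
    using Ck_on_Suc_has_derivative[OF Suc.prems(1) that] assms(1) that Suc.prems(2)
    by (rule has_derivative_transform_within_open)
  have "Ck_on k U (\<lambda>x. frechet_derivative G (at x) v)" for v
  proof (rule Suc.IH)
    show "Ck_on k U (\<lambda>x. frechet_derivative F (at x) v)" using Suc.prems(1) by simp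
    show "frechet_derivative F (at x) v = frechet_derivative G (at x) v" if "x \<in> U" for x
      by (rule fun_cong[OF frechet_derivative_at[OF D[OF that]]])
  qed
  moreover have "G differentiable (at x)" if "x \<in> U" for x
    using D[OF that] unfolding differentiable_def by blast
  ultimately show ?case by simp
qed

lemma Ck_on_SucI:
  assumes "open U"
    and D: "\<And>x. x \<in> U \<Longrightarrow> (F has_derivative F' x) (at x)"
    and "\<And>v. Ck_on k U (\<lambda>x. F' x v)"
  shows "Ck_on (Suc k) U F"
proof -
  have "Ck_on k U (\<lambda>x. frechet_derivative F (at x) v)" for v
    using assms(1,3) by (rule Ck_on_cong) (rule fun_cong[OF frechet_derivative_at[OF D]])
  moreover have "F differentiable (at x)" if "x \<in> U" for x
    using D[OF that] unfolding differentiable_def by blast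
  ultimately show ?thesis by simp
qed

lemma Ck_on_Suc_imp_Ck_on: "Ck_on (Suc k) U F \<Longrightarrow> Ck_on k U F"
proof (induction k arbitrary: F)
  case 0
  then show ?case
    by (auto intro!: continuous_at_imp_continuous_on differentiable_imp_continuous_within)
next
  case (Suc k)
  then show ?case unfolding Ck_on.simps(2)[of "Suc k"] Ck_on.simps(2)[of k U F] by blast
qed

lemma Ck_on_add:
  assumes "open U" "Ck_on k U F" "Ck_on k U G"
  shows "Ck_on k U (\<lambda>x. F x + G x)"
  using assms(2,3)
proof (induction k arbitrary: F G)
  case 0
  then show ?case by (simp add: continuous_on_add)
next
  case (Suc k)
  show ?case
  proof (rule Ck_on_SucI[OF assms(1)])
    show "((\<lambda>x. F x + G x) has_derivative
        (\<lambda>v. frechet_derivative F (at x) v + frechet_derivative G (at x) v)) (at x)"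
      if "x \<in> U" for x
      using Suc.prems[THEN Ck_on_Suc_has_derivative, OF that] by (rule has_derivative_add)
    show "Ck_on k U (\<lambda>x. frechet_derivative F (at x) v + frechet_derivative G (at x) v)" for v
      using Suc by simp
  qed
qed

lemma Ck_on_mult:
  fixes F G :: "'a::real_normed_vector \<Rightarrow> 'b::real_normed_algebra"
  assumes "open U" "Ck_on k U F" "Ck_on k U G"
  shows "Ck_on k U (\<lambda>x. F x * G x)"
  using assms(2,3)
proof (induction k arbitrary: F G)
  case 0
  then show ?case by (simp add: continuous_on_mult)
next
  case (Suc k)
  show ?case
  proof (rule Ck_on_SucI[OF assms(1)])
    show "((\<lambda>x. F x * G x) has_derivative
        (\<lambda>v. F x * frechet_derivative G (at x) v + frechet_derivative F (at x) v * G x)) (at x)"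
      if "x \<in> U" for x
      using Suc.prems[THEN Ck_on_Suc_has_derivative, OF that] by (rule has_derivative_mult)
    show "Ck_on k U (\<lambda>x. F x * frechet_derivative G (at x) v + frechet_derivative F (at x) v * G x)" for v
      using Suc.prems Suc.prems[THEN Ck_on_Suc_imp_Ck_on]
      by (intro Ck_on_add[OF assms(1)] Suc.IH) simp_all
  qed
qed

lemma Ck_on_const: "Ck_on k U (\<lambda>x. c)"
  by (induction k arbitrary: c) auto

lemma Ck_on_inverse:
  fixes F :: "'a::real_normed_vector \<Rightarrow> 'b::real_normed_field"
  assumes "open U" "Ck_on k U F" "\<And>x. x \<in> U \<Longrightarrow> F x \<noteq> 0"
  shows "Ck_on k U (\<lambda>x. inverse (F x))"
  using assms(2)
proof (induction k)
  case 0
  then show ?case using assms(3) by (simp add: continuous_on_inverse)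
next
  case (Suc k)
  show ?case
  proof (rule Ck_on_SucI[OF assms(1)])
    show "((\<lambda>x. inverse (F x)) has_derivative
        (\<lambda>v. - 1 * (inverse (F x) * frechet_derivative F (at x) v * inverse (F x)))) (at x)"
      if "x \<in> U" for x
      using Deriv.has_derivative_inverse[OF assms(3)[OF that] Ck_on_Suc_has_derivative[OF Suc.prems that]]
      by simp
    show "Ck_on k U (\<lambda>x. - 1 * (inverse (F x) * frechet_derivative F (at x) v * inverse (F x)))" for v
      using Suc.prems Suc.IH[OF Ck_on_Suc_imp_Ck_on[OF Suc.prems]]
      by (intro Ck_on_mult[OF assms(1)] Ck_on_const) simp_all
  qed
qed

lemma smooth_on_UNIV_deriv:
  fixes l :: "real \<Rightarrow> real"
  assumes "smooth_on UNIV l"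
  shows "(l has_real_derivative deriv l t) (at t)" "smooth_on UNIV (deriv l)"
proof -
  have "Ck_on (Suc k) UNIV l" for k using assms by (simp add: smooth_on_def)
  then have diff: "l differentiable (at x)" and Ck: "Ck_on k UNIV (\<lambda>x. frechet_derivative l (at x) 1)" for x k
    by auto
  show "(l has_real_derivative deriv l t) (at t)" for t
    by (rule DERIV_deriv_iff_real_differentiable[THEN iffD2, OF diff])
  then have "frechet_derivative l (at t) = (\<lambda>v. deriv l t * v)" for t
    using frechet_derivative_at[of l "\<lambda>v. deriv l t * v" t] by (simp add: has_field_derivative_def)
  with Ck show "smooth_on UNIV (deriv l)" by (simp add: smooth_on_def)
qed

text \<open>
  The induction runs over all \<open>Re (c F)\<close>, \<open>c\<close> a complex constant, because the derivative of \<open>Re (c F)\<close>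
  in the direction \<open>v\<close> is \<open>Re ((c v) F')\<close>, which is again of this kind.
\<close>

lemma smooth_on_Re_holomorphic:
  assumes "open U" "F holomorphic_on U"
  shows "smooth_on U (\<lambda>z. Re (F z))"
proof -
  have "Ck_on k U (\<lambda>z. Re (c * F z))" if "F holomorphic_on U" for k c F
    using that
  proof (induction k arbitrary: c F)
    case 0
    then show ?case by (auto intro!: continuous_intros holomorphic_on_imp_continuous_on)
  next
    case (Suc k)
    show ?case
    proof (rule Ck_on_SucI[OF assms(1)])
      show "((\<lambda>z. Re (c * F z)) has_derivative (\<lambda>v. Re (c * (deriv F z * v)))) (at z)" if "z \<in> U" for z
        using holomorphic_derivI[OF Suc.prems assms(1) that, unfolded has_field_derivative_def]
        by (intro bounded_linear.has_derivative[OF bounded_linear_Re] has_derivative_mult_right)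
      show "Ck_on k U (\<lambda>z. Re (c * (deriv F z * v)))" for v
        using Suc.IH[OF holomorphic_deriv[OF Suc.prems assms(1)], of "c * v"] by (simp add: mult_ac)
    qed
  qed
  from this[OF assms(2), of _ 1] show ?thesis by (simp add: smooth_on_def)
qed

lemma smooth_on_GRT_function:
  fixes l :: "real \<Rightarrow> real"
  assumes "smooth_on UNIV l" "\<forall>t. deriv l t \<noteq> 0"
  shows "smooth_on UNIV (\<lambda>t. l t * deriv (deriv l) t / (deriv l t)\<^sup>2)"
proof -
  have "Ck_on k UNIV (\<lambda>t. l t * deriv (deriv l) t * inverse (deriv l t * deriv l t))" for k
    using assms smooth_on_UNIV_deriv(2)[OF assms(1)] smooth_on_UNIV_deriv(2)[OF smooth_on_UNIV_deriv(2)[OF assms(1)]]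
    by (intro Ck_on_mult Ck_on_inverse) (auto simp: smooth_on_def)
  then show ?thesis by (simp add: smooth_on_def divide_inverse power2_eq_square)
qed

section \<open>Surfaces with prescribed support function in a complex parameter\<close>

text \<open>
  A patch of a surface in a complex parameter, with unit normal \<open>stereo \<circ> g\<close> and support function
  \<open>l(Re F)\<close>. The domain \<open>W\<close> is an arbitrary open set, because only small pieces of a chart are
  guaranteed to carry a function \<open>g\<close>.
\<close>

locale gauss_patch =
  fixes W :: "complex set" and g F :: "complex \<Rightarrow> complex"
    and x n :: "complex \<Rightarrow> complex \<times> real" and l :: "real \<Rightarrow> real"
  assumes open_W: "open W"
    and holo_g: "g holomorphic_on W" and deriv_g: "z \<in> W \<Longrightarrow> deriv g z \<noteq> 0"
    and holo_F: "F holomorphic_on W"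
    and x_diff: "z \<in> W \<Longrightarrow> x differentiable (at z)"
    and n_eq: "z \<in> W \<Longrightarrow> n z = stereo (g z)"
    and x_normal: "z \<in> W \<Longrightarrow> inner (frechet_derivative x (at z) v) (n z) = 0"
    and l_deriv: "(l has_real_derivative deriv l t) (at t)"
    and l_deriv2: "(deriv l has_real_derivative deriv (deriv l) t) (at t)"
    and support: "z \<in> W \<Longrightarrow> inner (x z) (n z) = l (Re (F z))"
begin

text \<open>
  The conformal factor of the third fundamental form.
\<close>

definition \<rho> :: "complex \<Rightarrow> real" where
  "\<rho> z = 4 * (cmod (deriv g z))\<^sup>2 / (1 + (cmod (g z))\<^sup>2)\<^sup>2"

definition dn :: "complex \<Rightarrow> complex \<Rightarrow> complex \<times> real" where
  "dn z v = dstereo (g z) (deriv g z * v)"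

lemma \<rho>_pos: "z \<in> W \<Longrightarrow> 0 < \<rho> z"
  using deriv_g one_plus_sq_pos(1)[of "g z"] by (simp add: \<rho>_def)

lemma F_deriv: "z \<in> W \<Longrightarrow> (F has_derivative (\<lambda>v. deriv F z * v)) (at z)"
  using holomorphic_derivI[OF holo_F open_W] by (simp add: has_field_derivative_def)

lemma F_deriv2: "z \<in> W \<Longrightarrow> (deriv F has_derivative (\<lambda>v. deriv (deriv F) z * v)) (at z)"
  using holomorphic_derivI[OF holomorphic_deriv[OF holo_F open_W] open_W] by (simp add: has_field_derivative_def)

lemma g_deriv: "z \<in> W \<Longrightarrow> (g has_derivative (\<lambda>v. deriv g z * v)) (at z)"
  using holomorphic_derivI[OF holo_g open_W] by (simp add: has_field_derivative_def)

lemma g_deriv2: "z \<in> W \<Longrightarrow> (deriv g has_derivative (\<lambda>v. deriv (deriv g) z * v)) (at z)"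
  using holomorphic_derivI[OF holomorphic_deriv[OF holo_g open_W] open_W] by (simp add: has_field_derivative_def)

lemma n_deriv:
  assumes "z \<in> W"
  shows "(n has_derivative dn z) (at z)"
proof -
  have "((\<lambda>z. stereo (g z)) has_derivative (\<lambda>v. dstereo (g z) (deriv g z * v))) (at z)"
    by (rule has_derivative_compose[OF g_deriv[OF assms] stereo_has_derivative])
  then show ?thesis
    unfolding dn_def using open_W assms by (rule has_derivative_transform_within_open) (simp add: n_eq)
qed

lemma frechet_n: "z \<in> W \<Longrightarrow> frechet_derivative n (at z) = dn z"
  using frechet_derivative_at[OF n_deriv] by simp

lemma linear_dn: "linear (dn z)"
  using linear_compose[OF _ linear_dstereo, of "\<lambda>v. deriv g z * v" "g z"]
  by (simp add: dn_def[abs_def] o_def linear_times)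

lemma inner_dn: "inner (dn z u) (dn z v) = \<rho> z * inner u v"
proof -
  have "inner (deriv g z * u) (deriv g z * v) = (cmod (deriv g z))\<^sup>2 * inner u v"
    by (simp add: inner_complex_def cmod_mult_self power2_eq_square algebra_simps)
  then show ?thesis by (simp add: dn_def \<rho>_def inner_dstereo)
qed

lemma inner_n_dn: "z \<in> W \<Longrightarrow> inner (n z) (dn z v) = 0"
  by (simp add: dn_def n_eq inner_stereo_dstereo)

lemma inner_n_n: "z \<in> W \<Longrightarrow> inner (n z) (n z) = 1"
  by (simp add: n_eq inner_stereo_self)

lemma inj_dn:
  assumes "z \<in> W"
  shows "inj (dn z)"
proof (rule linear_injective_0[THEN iffD2, OF linear_dn], intro allI impI)
  fix v assume "dn z v = 0"
  then have "\<rho> z * inner v v = 0" using inner_dn[of z v v] by simp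
  with \<rho>_pos[OF assms] show "v = 0" by simp
qed

lemma third_form_eq:
  assumes "z \<in> W"
  shows "third_form n 1 1 z = \<rho> z" "third_form n 2 2 z = \<rho> z"
    "third_form n 1 2 z = 0" "third_form n 2 1 z = 0"
  using assms by (simp_all add: third_form_def pd_def frechet_n inner_dn)

lemma eq_by_components:
  assumes "z \<in> W" "inner Y (n z) = inner Y' (n z)" "\<And>v. inner Y (dn z v) = inner Y' (dn z v)"
  shows "Y = Y'"
proof -
  have "inner (Y - Y') (dstereo (g z) u) = 0" for u
    using assms(3)[of "u / deriv g z"] deriv_g[OF assms(1)] by (simp add: dn_def inner_diff_left)
  then have "Y - Y' = 0"
    using assms(1,2) by (intro orthogonal_stereo_frame_imp_zero[of _ "g z"]) (simp_all add: inner_diff_left n_eq)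
  then show ?thesis by simp
qed

lemma x_deriv: "z \<in> W \<Longrightarrow> (x has_derivative frechet_derivative x (at z)) (at z)"
  using x_diff frechet_derivative_works by blast

lemma support_deriv:
  assumes "z \<in> W"
  shows "((\<lambda>z. inner (x z) (n z)) has_derivative (\<lambda>v. deriv l (Re (F z)) * Re (deriv F z * v))) (at z)"
proof -
  have "((\<lambda>z. l (Re (F z))) has_derivative (\<lambda>v. deriv l (Re (F z)) * Re (deriv F z * v))) (at z)"
    using has_derivative_compose[OF bounded_linear.has_derivative[OF bounded_linear_Re F_deriv[OF assms]]
        l_deriv[unfolded has_field_derivative_def]] .
  then show ?thesis
    using open_W assms by (rule has_derivative_transform_within_open) (simp add: support)
qed

text \<open>
  Since the velocity of \<open>x\<close> is orthogonal to \<open>n\<close>, differentiating the support function only sees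
  the motion of \<open>n\<close>: the tangential part of \<open>x\<close> is read off from the first derivatives of \<open>l(Re F)\<close>.
\<close>

lemma inner_x_dn:
  assumes "z \<in> W"
  shows "inner (x z) (dn z v) = deriv l (Re (F z)) * Re (deriv F z * v)"
proof -
  have "((\<lambda>z. inner (x z) (n z)) has_derivative
      (\<lambda>v. inner (x z) (dn z v) + inner (frechet_derivative x (at z) v) (n z))) (at z)"
    by (rule has_derivative_inner[OF x_deriv[OF assms] n_deriv[OF assms]])
  from fun_cong[OF has_derivative_unique[OF this support_deriv[OF assms]], of v]
  show ?thesis using x_normal[OF assms] by simp
qed

text \<open>
  The surface is recovered from its support function as gradient plus normal part; the gradient of
  \<open>Re F\<close> for the Euclidean metric of the parameter plane is \<open>cnj F'\<close>.
\<close>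

lemma position_eq:
  assumes "z \<in> W"
  shows "x z = dn z ((deriv l (Re (F z)) / \<rho> z) *\<^sub>R cnj (deriv F z)) + l (Re (F z)) *\<^sub>R n z"
proof (rule eq_by_components[OF assms])
  show "inner (x z) (n z) = inner (dn z ((deriv l (Re (F z)) / \<rho> z) *\<^sub>R cnj (deriv F z)) + l (Re (F z)) *\<^sub>R n z) (n z)"
    using support[OF assms] inner_n_dn[OF assms] inner_n_n[OF assms]
    by (simp add: inner_add_left inner_commute[of "dn z _"])
  show "inner (x z) (dn z v) = inner (dn z ((deriv l (Re (F z)) / \<rho> z) *\<^sub>R cnj (deriv F z)) + l (Re (F z)) *\<^sub>R n z) (dn z v)" for v
    using \<rho>_pos[OF assms] inner_n_dn[OF assms]
    by (simp add: inner_add_left inner_dn inner_x_dn[OF assms] inner_complex_def field_simps)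
qed

text \<open>
  The inverse \<open>S\<close> of the shape operator is, up to sign, the covariant Hessian of the support function
  for the third fundamental form plus the support function times the identity. It is found by
  differentiating \<open>\<langle>x, dn(v)\<rangle> = l'(Re F) Re (F' v)\<close> once more. With \<open>k\<close>, \<open>v\<close> the two directions, the
  normal part of the second derivative of \<open>n\<close> contributes \<open>\<rho> h \<langle>k, v\<rangle>\<close>, where \<open>h\<close> is the support
  function; its tangential part and the second derivative of \<open>F\<close> contribute terms \<open>Re (c k v)\<close>, which
  have no trace; and
  \<open>Re (F' k) Re (F' v)\<close> is half of \<open>Re (F'\<^sup>2 k v) + |F'|\<^sup>2 \<langle>k, v\<rangle>\<close>. So \<open>S\<close> has the form \<open>\<tau> v + q cnj v\<close>
  with an explicit \<open>\<tau>\<close>, half of its trace.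
\<close>

lemma dx_eq_dn_shape:
  assumes "z \<in> W"
  shows "\<exists>q. \<forall>v. frechet_derivative x (at z) v =
     dn z ((l (Re (F z)) + deriv (deriv l) (Re (F z)) * (cmod (deriv F z))\<^sup>2 / (2 * \<rho> z)) *\<^sub>R v + q * cnj v)"
proof -
  \<comment> \<open>The derivative of \<open>dn(v)\<close> in the direction \<open>k\<close> has the tangential part \<open>dn(\<kappa> k v)\<close>; \<open>Q\<close> collects
    the coefficients of all terms that are the real part of a multiple of \<open>k v\<close>.\<close>
  define T \<kappa> where "T = 1 + (cmod (g z))\<^sup>2" and
    "\<kappa> = deriv (deriv g) z / deriv g z - 2 * cnj (g z) * deriv g z / of_real T"
  define l0 l1 l2 where "l0 = l (Re (F z))" "l1 = deriv l (Re (F z))" "l2 = deriv (deriv l) (Re (F z))"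
  define Q where "Q = l2 * (deriv F z)\<^sup>2 / 2 + l1 * (deriv (deriv F) z - \<kappa> * deriv F z)"
  have hess: "inner (frechet_derivative x (at z) k) (dn z v)
      = \<rho> z * l0 * inner v k + l2 * Re (deriv F z * k) * Re (deriv F z * v)
        + l1 * Re ((deriv (deriv F) z - \<kappa> * deriv F z) * k * v)" for k v
  proof -
    define D where "D = (\<lambda>k. dn z (\<kappa> * v * k) - (\<rho> z * inner v k) *\<^sub>R n z)"
    have "((\<lambda>z. dn z v) has_derivative D) (at z)"
    proof -
      have "((\<lambda>z. deriv g z * v) has_derivative (\<lambda>k. deriv (deriv g) z * k * v)) (at z)"
        by (rule has_derivative_mult_left[OF g_deriv2[OF assms]])
      from dstereo_has_derivative[OF g_deriv[OF assms] this]
      show ?thesis unfolding dn_def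
      proof (rule has_derivative_eq_rhs, intro ext)
        fix k
        have "deriv (deriv g) z * k * v - 2 * cnj (g z) * (deriv g z * v) * (deriv g z * k) / complex_of_real (1 + (cmod (g z))\<^sup>2)
          = deriv g z * (\<kappa> * v * k)"
          using deriv_g[OF assms] by (simp add: \<kappa>_def T_def field_simps)
        moreover have "4 / (1 + (cmod (g z))\<^sup>2)\<^sup>2 * inner (deriv g z * v) (deriv g z * k) = \<rho> z * inner v k"
          using inner_dn[of z v k] by (simp only: dn_def inner_dstereo)
        ultimately show "dstereo (g z) (deriv (deriv g) z * k * v - 2 * cnj (g z) * (deriv g z * v) * (deriv g z * k) / complex_of_real (1 + (cmod (g z))\<^sup>2))
           - (4 / (1 + (cmod (g z))\<^sup>2)\<^sup>2 * inner (deriv g z * v) (deriv g z * k)) *\<^sub>R stereo (g z) = D k"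
          by (simp only: D_def dn_def n_eq[OF assms])
      qed
    qed
    from has_derivative_inner[OF x_deriv[OF assms] this]
    have lhs: "((\<lambda>z. inner (x z) (dn z v)) has_derivative
        (\<lambda>k. inner (x z) (D k) + inner (frechet_derivative x (at z) k) (dn z v))) (at z)" .
    have "((\<lambda>z. deriv l (Re (F z)) * Re (deriv F z * v)) has_derivative
        (\<lambda>k. deriv l (Re (F z)) * Re (deriv (deriv F) z * k * v) + (l2 * Re (deriv F z * k)) * Re (deriv F z * v))) (at z)"
    proof (rule has_derivative_mult)
      show "((\<lambda>z. deriv l (Re (F z))) has_derivative (\<lambda>k. l2 * Re (deriv F z * k))) (at z)"
        using has_derivative_compose[OF bounded_linear.has_derivative[OF bounded_linear_Re F_deriv[OF assms]]
          l_deriv2[unfolded has_field_derivative_def]] by (simp add: l0_l1_l2_def)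
      show "((\<lambda>z. Re (deriv F z * v)) has_derivative (\<lambda>k. Re (deriv (deriv F) z * k * v))) (at z)"
        by (intro bounded_linear.has_derivative[OF bounded_linear_Re] has_derivative_mult_left[OF F_deriv2[OF assms]])
    qed
    then have rhs: "((\<lambda>z. inner (x z) (dn z v)) has_derivative
        (\<lambda>k. deriv l (Re (F z)) * Re (deriv (deriv F) z * k * v) + (l2 * Re (deriv F z * k)) * Re (deriv F z * v))) (at z)"
      using open_W assms by (rule has_derivative_transform_within_open) (simp add: inner_x_dn)
    have "inner (x z) (D k) = l1 * Re (deriv F z * (\<kappa> * v * k)) - \<rho> z * inner v k * l0"
      unfolding D_def inner_diff_right inner_scaleR_right inner_x_dn[OF assms] support[OF assms] l0_l1_l2_def ..
    with fun_cong[OF has_derivative_unique[OF lhs rhs], of k, folded l0_l1_l2_def]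
    have "inner (frechet_derivative x (at z) k) (dn z v) =
       l1 * Re (deriv (deriv F) z * k * v) + (l2 * Re (deriv F z * k)) * Re (deriv F z * v) -
        (l1 * Re (deriv F z * (\<kappa> * v * k)) - \<rho> z * inner v k * l0)" by linarith
    then show ?thesis by (simp add: algebra_simps)
  qed
  have "frechet_derivative x (at z) k =
      dn z ((l0 + l2 * (cmod (deriv F z))\<^sup>2 / (2 * \<rho> z)) *\<^sub>R k + cnj Q / of_real (\<rho> z) * cnj k)" for k
  proof (rule eq_by_components[OF assms])
    show "inner (frechet_derivative x (at z) k) (n z) =
       inner (dn z ((l0 + l2 * (cmod (deriv F z))\<^sup>2 / (2 * \<rho> z)) *\<^sub>R k + cnj Q / of_real (\<rho> z) * cnj k)) (n z)"
      using x_normal[OF assms] inner_n_dn[OF assms] by (simp add: inner_commute[of "dn z _"])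
    fix v
    have "inner (dn z ((l0 + l2 * (cmod (deriv F z))\<^sup>2 / (2 * \<rho> z)) *\<^sub>R k + cnj Q / of_real (\<rho> z) * cnj k)) (dn z v)
      = (\<rho> z * l0 + l2 * (cmod (deriv F z))\<^sup>2 / 2) * inner k v + Re (Q * k * v)"
      unfolding inner_dn using \<rho>_pos[OF assms] by (simp add: inner_complex_def field_simps)
    also have "\<dots> = inner (frechet_derivative x (at z) k) (dn z v)"
      unfolding hess Q_def
      by (simp add: inner_complex_def cmod_mult_self power2_eq_square field_simps)
    finally show "inner (frechet_derivative x (at z) k) (dn z v) =
       inner (dn z ((l0 + l2 * (cmod (deriv F z))\<^sup>2 / (2 * \<rho> z)) *\<^sub>R k + cnj Q / of_real (\<rho> z) * cnj k)) (dn z v)" ..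
  qed
  then show ?thesis unfolding l0_l1_l2_def by blast
qed

lemma mean_over_gauss:
  assumes "z \<in> W" "inj (frechet_derivative x (at z))"
  shows "mean_curvature x n z / gauss_curvature x n z =
    - (l (Re (F z)) + deriv (deriv l) (Re (F z)) * (cmod (deriv F z))\<^sup>2 / (2 * \<rho> z))"
proof -
  obtain q where "\<And>v. frechet_derivative x (at z) v =
     dn z ((l (Re (F z)) + deriv (deriv l) (Re (F z)) * (cmod (deriv F z))\<^sup>2 / (2 * \<rho> z)) *\<^sub>R v + q * cnj v)"
    using dx_eq_dn_shape[OF assms(1)] by blast
  then have dx: "frechet_derivative x (at z) v = frechet_derivative n (at z)
      ((l (Re (F z)) + deriv (deriv l) (Re (F z)) * (cmod (deriv F z))\<^sup>2 / (2 * \<rho> z)) *\<^sub>R v + q * cnj v)" for v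
    by (simp only: frechet_n[OF assms(1)])
  show ?thesis
  proof (rule mean_over_gauss_curvature[OF _ _ assms(2) dx])
    show "linear (frechet_derivative n (at z))" "inj (frechet_derivative n (at z))"
      by (simp_all only: frechet_n[OF assms(1)] linear_dn inj_dn[OF assms(1)])
  qed
qed

lemma inner_x_x:
  assumes "z \<in> W"
  shows "inner (x z) (x z) = (deriv l (Re (F z)))\<^sup>2 * (cmod (deriv F z))\<^sup>2 / \<rho> z + (l (Re (F z)))\<^sup>2"
proof -
  define u where "u = (deriv l (Re (F z)) / \<rho> z) *\<^sub>R cnj (deriv F z)"
  have "inner (x z) (x z) = inner (dn z u) (dn z u) + (l (Re (F z)))\<^sup>2"
    unfolding position_eq[OF assms] u_def[symmetric]
    using inner_n_dn[OF assms] inner_n_n[OF assms]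
    by (simp add: inner_add_left inner_add_right inner_commute[of "dn z u" "n z"] power2_eq_square)
  also have "inner (dn z u) (dn z u) = (deriv l (Re (F z)))\<^sup>2 * (cmod (deriv F z))\<^sup>2 / \<rho> z"
    unfolding inner_dn using \<rho>_pos[OF assms]
    by (simp add: u_def power2_norm_eq_inner[symmetric] field_simps power2_eq_square)
  finally show ?thesis .
qed

text \<open>
  By Pythagoras \<open>\<Lambda> - \<Psi>\<^sup>2\<close> is the squared length \<open>l'\<^sup>2 |F'|\<^sup>2 / \<rho>\<close> of the gradient of the support
  function, and \<open>H / K + \<Psi>\<close> is \<open>- l'' |F'|\<^sup>2 / (2 \<rho>)\<close>. Eliminating the common
  factor \<open>|F'|\<^sup>2 / \<rho>\<close> leaves a relation whose coefficient depends on \<open>Re F\<close> alone.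
\<close>

lemma GRT_equation:
  assumes "z \<in> W" "inj (frechet_derivative x (at z))" "l (Re (F z)) \<noteq> 0" "deriv l (Re (F z)) \<noteq> 0"
  shows "mean_curvature x n z / gauss_curvature x n z =
     l (Re (F z)) * deriv (deriv l) (Re (F z)) / (deriv l (Re (F z)))\<^sup>2 *
       (- quadratic_distance x z / (2 * support_function x n z) + support_function x n z / 2)
     - support_function x n z"
proof -
  define a b c e r where "a = l (Re (F z))" "b = deriv l (Re (F z))" "c = deriv (deriv l) (Re (F z))"
    "e = (cmod (deriv F z))\<^sup>2" "r = \<rho> z"
  note abcer = this
  have nz: "a \<noteq> 0" "b \<noteq> 0" "r \<noteq> 0"
    using assms(3,4) \<rho>_pos[OF assms(1)] by (auto simp: abcer)
  have bracket: "- (b\<^sup>2 * e / r + a\<^sup>2) / (2 * a) + a / 2 = - (b\<^sup>2 * e / (2 * r * a))"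
    using nz by (simp add: field_simps power2_eq_square)
  have "- (a + c * e / (2 * r)) = a * c / b\<^sup>2 * (- (b\<^sup>2 * e / r + a\<^sup>2) / (2 * a) + a / 2) - a"
    unfolding bracket using nz by simp
  then show ?thesis
    by (simp only: mean_over_gauss[OF assms(1,2)] quadratic_distance_def support_function_def
      inner_x_x[OF assms(1)] support[OF assms(1)] abcer)
qed

lemma position_gradient:
  assumes "z \<in> W" "\<And>w. w \<in> W \<Longrightarrow> h w = inner (x w) (n w)"
  shows "x z = (\<Sum>j\<in>{1, 2}. (pd j h z / third_form n j j z) *\<^sub>R pd j n z) + h z *\<^sub>R n z"
proof -
  have "(h has_derivative (\<lambda>v. deriv l (Re (F z)) * Re (deriv F z * v))) (at z)"
    using support_deriv[OF assms(1)] open_W assms(1)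
    by (rule has_derivative_transform_within_open) (simp add: assms(2))
  note h = frechet_derivative_at[OF this, symmetric]
  define c where "c = deriv l (Re (F z)) / \<rho> z"
  have "(\<Sum>j\<in>{1, 2}. (pd j h z / third_form n j j z) *\<^sub>R pd j n z)
      = (c * Re (deriv F z)) *\<^sub>R dn z 1 + (c * - Im (deriv F z)) *\<^sub>R dn z \<i>"
    using third_form_eq[OF assms(1)] by (simp add: pd_def h frechet_n[OF assms(1)] c_def)
  also have "\<dots> = dn z ((c * Re (deriv F z)) *\<^sub>R 1 + (c * - Im (deriv F z)) *\<^sub>R \<i>)"
    by (simp only: linear_add[OF linear_dn] linear_scale[OF linear_dn])
  also have "(c * Re (deriv F z)) *\<^sub>R 1 + (c * - Im (deriv F z)) *\<^sub>R \<i> = c *\<^sub>R cnj (deriv F z)"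
    by (simp add: complex_eq_iff)
  finally show ?thesis
    using position_eq[OF assms(1)] support[OF assms(1)] assms(2)[OF assms(1)] by (simp add: c_def)
qed

text \<open>
  In dimension two the Laplacian of a conformal metric is, up to a factor, the Euclidean one:
  \<open>\<rho>\<close> cancels in the flux, which leaves the Cauchy-Riemann equations for \<open>F'\<close>.
\<close>

lemma harmonic:
  assumes "z \<in> W" "\<And>w. w \<in> W \<Longrightarrow> m w = Re (F w)"
  shows "laplace_beltrami (third_form n) m z = 0"
proof -
  have m: "frechet_derivative m (at w) = (\<lambda>v. Re (deriv F w * v))" if "w \<in> W" for w
  proof -
    have "(m has_derivative (\<lambda>v. Re (deriv F w * v))) (at w)"
      using bounded_linear.has_derivative[OF bounded_linear_Re F_deriv[OF that]] open_W that
      by (rule has_derivative_transform_within_open) (simp add: assms(2))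
    from frechet_derivative_at[OF this, symmetric] show ?thesis .
  qed
  define flux where "flux = (\<lambda>i w. sqrt (metric_det (third_form n) w) *
        (\<Sum>j\<in>{1, 2}. metric_inv (third_form n) i j w * pd j m w))"
  have flux: "flux 1 w = Re (deriv F w * 1)" "flux 2 w = Re (deriv F w * \<i>)" if "w \<in> W" for w
    using \<rho>_pos[OF that] third_form_eq[OF that]
    by (simp_all add: flux_def metric_det_def metric_inv_def pd_def m[OF that] third_form_eq[OF that, unfolded One_nat_def])
  have pd_flux: "pd j (flux i) z = Re (deriv (deriv F) z * (if j = 1 then 1 else \<i>) * e)"
    if "\<And>w. w \<in> W \<Longrightarrow> flux i w = Re (deriv F w * e)" for i j e
  proof -
    have "((\<lambda>w. Re (deriv F w * e)) has_derivative (\<lambda>v. Re (deriv (deriv F) z * v * e))) (at z)"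
      by (intro bounded_linear.has_derivative[OF bounded_linear_Re] has_derivative_mult_left F_deriv2 assms(1))
    then have "(flux i has_derivative (\<lambda>v. Re (deriv (deriv F) z * v * e))) (at z)"
      using open_W assms(1) by (rule has_derivative_transform_within_open) (simp add: that)
    from frechet_derivative_at[OF this, symmetric] show ?thesis by (simp only: pd_def)
  qed
  have "pd 1 (flux 1) z + pd 2 (flux 2) z = 0"
    using pd_flux[of 1 1 1] pd_flux[of 2 \<i> 2] flux by simp
  moreover have "laplace_beltrami (third_form n) m z
      = (\<Sum>i\<in>{1, 2}. pd i (flux i) z) / sqrt (metric_det (third_form n) z)"
    unfolding laplace_beltrami_def flux_def by (rule refl)
  ultimately show ?thesis by simp
qed

text \<open>
  This expands the gradient in \<open>position_eq\<close>; the identity \<open>tangent\<close> rewrites \<open>dstereo\<close> at \<open>g' cnj F'\<close> with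
  \<open>g\<^sup>2 cnj (g' cnj F') = 2 g \<langle>g', g F'\<rangle> - |g|\<^sup>2 g' cnj F'\<close>.
\<close>

lemma position_explicit:
  assumes "z \<in> W"
  defines "T \<equiv> 1 + (cmod (g z))\<^sup>2"
  shows "x z = (deriv l (Re (F z)) / (2 * (cmod (deriv g z))\<^sup>2)) *\<^sub>R
       (complex_of_real T * deriv g z * cnj (deriv F z)
          - 2 * g z * complex_of_real (inner (deriv g z) (g z * deriv F z)),
        - 2 * inner (deriv g z) (g z * deriv F z))
     + l (Re (F z)) *\<^sub>R ((2 * g z, 2 - T) /\<^sub>R T)"
proof -
  have T: "T \<noteq> 0" "1 + (cmod (g z))\<^sup>2 = T" using one_plus_sq_pos(2)[of "g z"] by (auto simp: T_def)
  define c where "c = deriv l (Re (F z))"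
  have "n z = (2 * g z, 2 - T) /\<^sub>R T"
    by (simp add: n_eq[OF assms(1)] stereo_def T_def)
  moreover have "dn z ((c / \<rho> z) *\<^sub>R cnj (deriv F z)) =
      (c / (2 * (cmod (deriv g z))\<^sup>2)) *\<^sub>R
       (complex_of_real T * deriv g z * cnj (deriv F z)
          - 2 * g z * complex_of_real (inner (deriv g z) (g z * deriv F z)),
        - 2 * inner (deriv g z) (g z * deriv F z))"
  proof -
    have tangent: "(deriv g z * cnj (deriv F z) - (g z)\<^sup>2 * cnj (deriv g z * cnj (deriv F z)),
        - 2 * inner (g z) (deriv g z * cnj (deriv F z)))
      = (complex_of_real T * deriv g z * cnj (deriv F z)
          - 2 * g z * complex_of_real (inner (deriv g z) (g z * deriv F z)),
        - 2 * inner (deriv g z) (g z * deriv F z))"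
      by (intro prod_eqI complex_eqI)
         (simp_all add: T_def inner_complex_def cmod_mult_self power2_eq_square algebra_simps)
    have "dn z ((c / \<rho> z) *\<^sub>R cnj (deriv F z)) = (c / \<rho> z) *\<^sub>R dn z (cnj (deriv F z))"
      by (simp add: linear_scale[OF linear_dn])
    also have "\<dots> = (c / \<rho> z * (2 / T\<^sup>2)) *\<^sub>R
       (complex_of_real T * deriv g z * cnj (deriv F z)
          - 2 * g z * complex_of_real (inner (deriv g z) (g z * deriv F z)),
        - 2 * inner (deriv g z) (g z * deriv F z))"
      unfolding dn_def dstereo_def T(2) tangent by (simp only: scaleR_scaleR)
    also have "c / \<rho> z * (2 / T\<^sup>2) = c / (2 * (cmod (deriv g z))\<^sup>2)"
      using T(1) deriv_g[OF assms(1)] by (simp add: \<rho>_def T(2) field_simps)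
    finally show ?thesis .
  qed
  ultimately show ?thesis
    using position_eq[OF assms(1)] by (simp only: c_def)
qed

end

section \<open>Passage between charts\<close>

lemma complex_chartD:
  assumes "complex_chart S U \<phi>"
  shows "inj_on \<phi> U" "open (\<phi> ` U)" "U \<subseteq> topspace S"
    "openin S V \<Longrightarrow> open (\<phi> ` (U \<inter> V))"
proof -
  have US: "openin S U" and op: "open (\<phi> ` U)"
    and hom: "homeomorphic_map (subtopology S U) (top_of_set (\<phi> ` U)) \<phi>"
    using assms by (auto simp: complex_chart_def)
  show "open (\<phi> ` U)" by (fact op)
  show U: "U \<subseteq> topspace S" using US by (rule openin_subset)
  show "inj_on \<phi> U"
    using homeomorphic_imp_injective_map[OF hom] U by (simp add: Int_absorb1)
  show "open (\<phi> ` (U \<inter> V))" if "openin S V"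
  proof -
    have "openin (subtopology S U) (U \<inter> V)"
      using that by (simp add: openin_subtopology_Int2)
    then have "openin (top_of_set (\<phi> ` U)) (\<phi> ` (U \<inter> V))"
      using homeomorphic_imp_open_map[OF hom] by (simp add: open_map_def)
    then show ?thesis using op openin_open_trans by blast
  qed
qed

text \<open>
  The chart-independent hypotheses of the theorem that the reduction to patches needs; the function
  \<open>\<mu>\<close> is already replaced by the real part of \<open>f\<close>.
\<close>

locale support_surface =
  fixes S :: "'a topology" and A :: "'a chart set"
    and X N :: "'a \<Rightarrow> complex \<times> real" and f :: "'a \<Rightarrow> complex" and l :: "real \<Rightarrow> real"
  assumes riemann: "riemann_surface S A"
    and immersion: "immersion A X"
    and gauss: "gauss_map A X N"
    and gauss_local: "\<forall>p\<in>topspace S. \<exists>(U, \<phi>)\<in>A. p \<in> U \<and> (\<exists>g. gauss_map_given_by U \<phi> N g)"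
    and l_smooth: "smooth_on UNIV l"
    and f_holo: "holomorphic_on_surface A f"
    and support: "\<forall>p\<in>topspace S. inner (X p) (N p) = l (Re (f p))"
begin

lemma chart: "(U, \<phi>) \<in> A \<Longrightarrow> complex_chart S U \<phi>"
  using riemann by (auto simp: riemann_surface_def)

lemma smooth_differentiable: "smooth_on V F \<Longrightarrow> z \<in> V \<Longrightarrow> F differentiable (at z)"
  unfolding smooth_on_def by (metis Ck_on.simps(2))

lemma gauss_patchI:
  assumes U: "(U, \<phi>) \<in> A" and W: "open W" "W \<subseteq> \<phi> ` U"
    and g: "g holomorphic_on W" "\<And>z. z \<in> W \<Longrightarrow> deriv g z \<noteq> 0"
    and N: "\<And>z. z \<in> W \<Longrightarrow> in_chart U \<phi> N z = stereo (g z)"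
  shows "gauss_patch W g (in_chart U \<phi> f) (in_chart U \<phi> X) (in_chart U \<phi> N) l"
proof
  show "in_chart U \<phi> f holomorphic_on W"
    using f_holo U W(2) unfolding holomorphic_on_surface_def by (blast intro: holomorphic_on_subset)
  show "(l has_real_derivative deriv l t) (at t)" "(deriv l has_real_derivative deriv (deriv l) t) (at t)" for t
    by (intro smooth_on_UNIV_deriv l_smooth)+
  fix z assume z: "z \<in> W"
  show "in_chart U \<phi> X differentiable (at z)"
    using immersion U W(2) z by (auto simp: immersion_def intro: smooth_differentiable)
  show "inner (frechet_derivative (in_chart U \<phi> X) (at z) v) (in_chart U \<phi> N z) = 0" for v
    using gauss U W(2) z unfolding gauss_map_def by blast
  have "inv_into U \<phi> z \<in> topspace S"
    using complex_chartD(3)[OF chart[OF U]] W(2) z by (meson inv_into_into subsetD)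
  then show "inner (in_chart U \<phi> X z) (in_chart U \<phi> N z) = l (Re (in_chart U \<phi> f z))"
    using support by (simp add: in_chart_def)
qed (use assms in auto)

lemma gauss_patch_given_by:
  assumes "(U, \<phi>) \<in> A" "gauss_map_given_by U \<phi> N g"
  shows "gauss_patch (\<phi> ` U) g (in_chart U \<phi> f) (in_chart U \<phi> X) (in_chart U \<phi> N) l"
  using assms complex_chartD(2)[OF chart[OF assms(1)]]
  by (intro gauss_patchI) (auto simp: gauss_map_given_by_def stereo_def)

text \<open>
  A chart may meet points where the normal is the south pole, so that in its own parameter no
  holomorphic \<open>g\<close> represents the whole Gauss map. Near a given point another chart does have such a
  \<open>g\<close>, and composing it with the change of parameter, which is holomorphic and injective and
  therefore has nowhere vanishing derivative, gives one on a neighbourhood in the given chart.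
\<close>

lemma gauss_patch_near:
  assumes U: "(U, \<phi>) \<in> A" and z: "z \<in> \<phi> ` U"
  obtains W g where "z \<in> W" "gauss_patch W g (in_chart U \<phi> f) (in_chart U \<phi> X) (in_chart U \<phi> N) l"
proof -
  define p where "p = inv_into U \<phi> z"
  have p: "p \<in> U" "\<phi> p = z" using z by (auto simp: p_def inv_into_into f_inv_into_f)
  then have "p \<in> topspace S" using complex_chartD(3)[OF chart[OF U]] by blast
  with gauss_local obtain V \<psi> g where V: "(V, \<psi>) \<in> A" "p \<in> V" and g: "gauss_map_given_by V \<psi> N g"
    by blast
  note cU = complex_chartD[OF chart[OF U]] and cV = complex_chartD[OF chart[OF V(1)]]
  define W where "W = \<phi> ` (U \<inter> V)"
  define t where "t = \<psi> \<circ> inv_into U \<phi>"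
  have W: "open W" "W \<subseteq> \<phi> ` U" "z \<in> W"
    using cU(4) chart[OF V(1)] p V(2) by (auto simp: W_def complex_chart_def)
  have tW: "t (\<phi> r) = \<psi> r" if "r \<in> U" for r
    using cU(1) that by (simp add: t_def)
  have t_holo: "t holomorphic_on W"
  proof -
    have "\<forall>(U, \<phi>)\<in>A. \<forall>(V, \<psi>)\<in>A. (\<psi> \<circ> inv_into U \<phi>) holomorphic_on (\<phi> ` (U \<inter> V))"
      using riemann unfolding riemann_surface_def by (elim conjE)
    from bspec[OF bspec[OF this U, unfolded prod.case] V(1), unfolded prod.case] show ?thesis
      unfolding t_def W_def .
  qed
  have "inj_on t W"
    using cV(1) by (auto simp: W_def tW inj_on_def)
  then have t_deriv: "deriv t w \<noteq> 0" if "w \<in> W" for w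
    using holomorphic_injective_imp_regular[OF t_holo W(1) _ that] by blast
  have g_holo: "g holomorphic_on \<psi> ` V" and g_deriv: "\<And>y. y \<in> \<psi> ` V \<Longrightarrow> deriv g y \<noteq> 0"
    and g_N: "\<And>y. y \<in> \<psi> ` V \<Longrightarrow> in_chart V \<psi> N y = stereo (g y)"
    using g unfolding gauss_map_given_by_def stereo_def by blast+
  have tV: "t ` W \<subseteq> \<psi> ` V" by (auto simp: W_def tW)
  have "gauss_patch W (g \<circ> t) (in_chart U \<phi> f) (in_chart U \<phi> X) (in_chart U \<phi> N) l"
  proof (rule gauss_patchI[OF U W(1,2)])
    show "g \<circ> t holomorphic_on W"
      by (rule holomorphic_on_compose_gen[OF t_holo g_holo tV])
    fix w assume w: "w \<in> W"
    then have tw: "t w \<in> \<psi> ` V" using tV by blast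
    have "g field_differentiable at (t w)"
      by (rule holomorphic_on_imp_differentiable_at[OF g_holo cV(2) tw])
    moreover have "t field_differentiable at w"
      by (rule holomorphic_on_imp_differentiable_at[OF t_holo W(1) w])
    ultimately have "deriv (g \<circ> t) w = deriv g (t w) * deriv t w"
      by (rule deriv_chain[rotated])
    then show "deriv (g \<circ> t) w \<noteq> 0" using t_deriv[OF w] g_deriv[OF tw] by simp
    obtain r where r: "r \<in> U" "r \<in> V" "w = \<phi> r" using w by (auto simp: W_def)
    have "in_chart U \<phi> N w = in_chart V \<psi> N (t w)"
      using r cU(1) cV(1) by (simp add: in_chart_def tW)
    also have "\<dots> = stereo (g (t w))"
      by (rule g_N[OF tw])
    finally show "in_chart U \<phi> N w = stereo ((g \<circ> t) w)" by simp
  qed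
  from that[OF W(3) this] show ?thesis .
qed

end

section \<open>The representation of the surface\<close>

theorem theorem2p4:
  fixes S :: "'a topology"
    and A :: "'a chart set"
    and X N :: "'a \<Rightarrow> complex \<times> real"
    and f :: "'a \<Rightarrow> complex"
    and l :: "real \<Rightarrow> real"
    and \<mu> h :: "'a \<Rightarrow> real"
  assumes "riemann_surface S A"
    and "immersion A X"
    and "gauss_map A X N"
    and "nonzero_curvature A X N"
    and "\<forall>p\<in>topspace S. \<exists>(U, \<phi>)\<in>A. p \<in> U \<and> (\<exists>g. gauss_map_given_by U \<phi> N g)"
    and "smooth_on UNIV l"
    and "\<forall>t. deriv l t \<noteq> 0"
    and "holomorphic_on_surface A f"
    and "\<mu> = (\<lambda>p. inner 1 (f p))"
    and "h = support_function X N"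
    and "\<forall>p\<in>topspace S. h p = l (\<mu> p)"
    and "\<forall>p\<in>topspace S. h p \<noteq> 0"
  shows "(\<forall>(U, \<phi>)\<in>A. \<forall>z\<in>\<phi> ` U.
            let n = in_chart U \<phi> N; h' = in_chart U \<phi> h
            in in_chart U \<phi> X z =
                 (\<Sum>j\<in>{1, 2}. (pd j h' z / third_form n j j z) *\<^sub>R pd j n z) + h' z *\<^sub>R n z)
       \<and> GRT_surface A X N \<mu> (\<lambda>t. l t * deriv (deriv l) t / (deriv l t)\<^sup>2)
       \<and> (\<forall>(U, \<phi>)\<in>A. \<forall>g. gauss_map_given_by U \<phi> N g \<longrightarrow>
            (\<forall>z\<in>\<phi> ` U.
               let g0 = g z; g1 = deriv g z; f1 = deriv (in_chart U \<phi> f) z;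
                   m = in_chart U \<phi> \<mu> z; T = 1 + (cmod g0)\<^sup>2
               in in_chart U \<phi> X z =
                    (deriv l m / (2 * (cmod g1)\<^sup>2)) *\<^sub>R
                      (complex_of_real T * g1 * cnj f1 - 2 * g0 * complex_of_real (inner g1 (g0 * f1)),
                       - 2 * inner g1 (g0 * f1))
                    + l m *\<^sub>R ((2 * g0, 2 - T) /\<^sub>R T)))"
proof -
  have \<mu>_eq: "in_chart U \<phi> \<mu> = (\<lambda>z. Re (in_chart U \<phi> f z))" for U \<phi>
    by (simp add: assms(9) in_chart_def fun_eq_iff inner_complex_def)
  interpret support_surface S A X N f l
  proof
    show "\<forall>p\<in>topspace S. inner (X p) (N p) = l (Re (f p))"
      using assms(9-11) by (simp add: support_function_def inner_complex_def)
  qed fact+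
  have nonzero: "l (Re (in_chart U \<phi> f z)) \<noteq> 0" if "(U, \<phi>) \<in> A" "z \<in> \<phi> ` U" for U \<phi> z
  proof -
    have "inv_into U \<phi> z \<in> topspace S"
      using complex_chartD(3)[OF chart[OF that(1)]] inv_into_into[OF that(2)] by blast
    then show ?thesis
      using assms(9,11,12) by (simp add: in_chart_def inner_complex_def)
  qed
  have representation: "in_chart U \<phi> X z =
      (\<Sum>j\<in>{1, 2}. (pd j (in_chart U \<phi> h) z / third_form (in_chart U \<phi> N) j j z) *\<^sub>R pd j (in_chart U \<phi> N) z)
        + in_chart U \<phi> h z *\<^sub>R in_chart U \<phi> N z"
    if "(U, \<phi>) \<in> A" "z \<in> \<phi> ` U" for U \<phi> z
  proof -
    from gauss_patch_near[OF that] obtain W g where "z \<in> W" and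
      patch: "gauss_patch W g (in_chart U \<phi> f) (in_chart U \<phi> X) (in_chart U \<phi> N) l" .
    then show ?thesis
      by (intro gauss_patch.position_gradient[OF patch])
         (simp_all add: assms(10) in_chart_def support_function_def)
  qed
  have harmonic: "harmonic_third_form A N \<mu>"
  proof -
    have "smooth_on (\<phi> ` U) (in_chart U \<phi> \<mu>)" if "(U, \<phi>) \<in> A" for U \<phi>
      unfolding \<mu>_eq using f_holo that complex_chartD(2)[OF chart[OF that]]
      by (intro smooth_on_Re_holomorphic) (auto simp: holomorphic_on_surface_def)
    moreover have "laplace_beltrami (third_form (in_chart U \<phi> N)) (in_chart U \<phi> \<mu>) z = 0"
      if "(U, \<phi>) \<in> A" "z \<in> \<phi> ` U" for U \<phi> z
    proof -
      from gauss_patch_near[OF that] obtain W g where "z \<in> W" and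
        patch: "gauss_patch W g (in_chart U \<phi> f) (in_chart U \<phi> X) (in_chart U \<phi> N) l" .
      then show ?thesis
        by (intro gauss_patch.harmonic[OF patch]) (simp_all add: \<mu>_eq)
    qed
    ultimately show ?thesis unfolding harmonic_third_form_def by blast
  qed
  have grt: "support_function (in_chart U \<phi> X) (in_chart U \<phi> N) z \<noteq> 0 \<and>
      mean_curvature (in_chart U \<phi> X) (in_chart U \<phi> N) z / gauss_curvature (in_chart U \<phi> X) (in_chart U \<phi> N) z =
        l (in_chart U \<phi> \<mu> z) * deriv (deriv l) (in_chart U \<phi> \<mu> z) / (deriv l (in_chart U \<phi> \<mu> z))\<^sup>2 *
        (- quadratic_distance (in_chart U \<phi> X) z / (2 * support_function (in_chart U \<phi> X) (in_chart U \<phi> N) z)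
           + support_function (in_chart U \<phi> X) (in_chart U \<phi> N) z / 2)
        - support_function (in_chart U \<phi> X) (in_chart U \<phi> N) z"
    if "(U, \<phi>) \<in> A" "z \<in> \<phi> ` U" for U \<phi> z
  proof -
    from gauss_patch_near[OF that] obtain W g where z: "z \<in> W" and
      patch: "gauss_patch W g (in_chart U \<phi> f) (in_chart U \<phi> X) (in_chart U \<phi> N) l" .
    have "inj (frechet_derivative (in_chart U \<phi> X) (at z))"
      using immersion that unfolding immersion_def by blast
    then show ?thesis
      using gauss_patch.GRT_equation[OF patch z] gauss_patch.support[OF patch z] nonzero[OF that] assms(7)
      by (simp add: \<mu>_eq support_function_def)
  qed
  have "GRT_surface A X N \<mu> (\<lambda>t. l t * deriv (deriv l) t / (deriv l t)\<^sup>2)"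
    unfolding GRT_surface_def Let_def
    using assms(2-4) harmonic smooth_on_GRT_function[OF assms(6,7)] grt by blast
  moreover have "in_chart U \<phi> X z =
      (deriv l (in_chart U \<phi> \<mu> z) / (2 * (cmod (deriv g z))\<^sup>2)) *\<^sub>R
        (complex_of_real (1 + (cmod (g z))\<^sup>2) * deriv g z * cnj (deriv (in_chart U \<phi> f) z)
           - 2 * g z * complex_of_real (inner (deriv g z) (g z * deriv (in_chart U \<phi> f) z)),
         - 2 * inner (deriv g z) (g z * deriv (in_chart U \<phi> f) z))
      + l (in_chart U \<phi> \<mu> z) *\<^sub>R ((2 * g z, 2 - (1 + (cmod (g z))\<^sup>2)) /\<^sub>R (1 + (cmod (g z))\<^sup>2))"
    if "(U, \<phi>) \<in> A" "gauss_map_given_by U \<phi> N g" "z \<in> \<phi> ` U" for U \<phi> g z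
    unfolding \<mu>_eq by (rule gauss_patch.position_explicit[OF gauss_patch_given_by[OF that(1,2)] that(3)])
  ultimately show ?thesis
    unfolding Let_def using representation by blast
qed

end
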